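(* Let $q$ be a prime power, let $n$ be a positive integer and let $s$ be an integer with $\gcd(s,2n)=1$. Let $k$ be an integer with $1\le k\le 2n-1$. Let $\gamma\in\mathbb F_{q^{2n}}$ be such that $N(\gamma)$ is a non-square in $\mathbb F_q$, where $N=N_{q^{2n}/q}$ is the norm from $\mathbb F_{q^{2n}}$ to $\mathbb F_q$. Define $$\mathcal D_{k,s}(\gamma)=\Big\{aX+\sum_{i=1}^{k-1}c_iX^{q^{is}}+\gamma bX^{q^{ks}} : c_1,\dots,c_{k-1}\in\mathbb F_{q^{2n}},\ a,b\in\mathbb F_{q^n}\Big\}.$$ Then $\mathcal D_{k,s}(\gamma)$ is an MRD code (in $\mathbb F_q^{2n\times 2n}$).
   Context: A $q$-polynomial (linearized polynomial) over $\mathbb F_{q^{2n}}$ is a polynomial $\sum_i c_iX^{q^i}$ with $c_i\in\mathbb F_{q^{2n}}$; $q$-polynomials are considered modulo $X^{q^{2n}}-X$ (so the exponent $i$ in $X^{q^i}$ is read modulo $2n$), and are identified with the $\mathbb F_q$-linear maps $\mathbb F_{q^{2n}}\to\mathbb F_{q^{2n}}$, i.e. with matrices in $\mathbb F_q^{2n\times 2n}$. The rank distance is $d(A,B)=\mathrm{rank}(A-B)$. For a set $\mathcal C\subseteq\mathbb F_q^{2n\times 2n}$ with at least two elements, its minimum distance is $d(\mathcal C)=\min\{d(A,B):A,B\in\mathcal C,\ A\ne B\}$. A code $\mathcal C\subseteq \mathbb F_q^{2n\times 2n}$ of minimum distance $d$ satisfies $\#\mathcal C\le q^{2n(2n-d+1)}$,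 and it is called a maximum rank-distance (MRD) code if equality holds. *)

theory Defs
  imports
    "HOL-Library.Cardinality"
    "HOL-Computational_Algebra.Polynomial"
    "HOL-Number_Theory.Prime_Powers"
begin

text \<open>
  The ground field F_q is a finite field type \<open>'k\<close>, the extension of order \<open>q^(2n)\<close> is a finite
  field type \<open>'a\<close>, and F_q is seen inside it through a field embedding.
\<close>

definition field_embedding :: "('k::field \<Rightarrow> 'a::field) \<Rightarrow> bool" where
  "field_embedding emb \<longleftrightarrow>
     emb 1 = 1 \<and> (\<forall>x y. emb (x + y) = emb x + emb y) \<and> (\<forall>x y. emb (x * y) = emb x * emb y)"

definition ext_scale :: "('k::field \<Rightarrow> 'a::field) \<Rightarrow> 'k \<Rightarrow> 'a \<Rightarrow> 'a" where
  "ext_scale emb c x = emb c * x"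

text \<open>
  In a field with \<open>q^m\<close> elements, where \<open>r\<close> divides \<open>m\<close>, the unique subfield with \<open>q^r\<close> elements
  consists of the roots of \<open>X^(q^r) - X\<close>.
\<close>

definition fixed_subfield :: "nat \<Rightarrow> nat \<Rightarrow> 'a::field set" where
  "fixed_subfield q r = {x. x ^ (q ^ r) = x}"

text \<open>
  The norm from F_{q^m} to F_q as the product of the conjugates, still as an element of F_{q^m}.
\<close>

definition ext_norm :: "nat \<Rightarrow> nat \<Rightarrow> 'a::field \<Rightarrow> 'a" where
  "ext_norm q m x = (\<Prod>i<m. x ^ (q ^ i))"

text \<open>
  \<open>qmonom q m c j\<close> is \<open>c X^(q^j)\<close> modulo \<open>X^(q^m) - X\<close>: the index \<open>j\<close>, possibly negative, is
  replaced by its representative in \<open>{0..<m}\<close>.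
\<close>

definition qmonom :: "nat \<Rightarrow> nat \<Rightarrow> 'a::field \<Rightarrow> int \<Rightarrow> 'a poly" where
  "qmonom q m c j = monom c (q ^ nat (j mod int m))"

definition D_poly :: "nat \<Rightarrow> nat \<Rightarrow> nat \<Rightarrow> int \<Rightarrow> 'a::field \<Rightarrow> 'a poly set" where
  "D_poly q n k s \<gamma> =
     {qmonom q (2 * n) a 0
        + (\<Sum>i = 1..k - 1. qmonom q (2 * n) (c i) (int i * s))
        + qmonom q (2 * n) (\<gamma> * b) (int k * s) | a b c.
        a \<in> fixed_subfield q n \<and> b \<in> fixed_subfield q n}"

text \<open>
  The \<open>m \<times> m\<close> matrices over F_q are taken basis-free, as the F_q-linear endomaps of the
  \<open>m\<close>-dimensional F_q-space \<open>'a\<close>; the rank is the dimension of the image. A linearized polynomial is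
  identified with the map it induces, \<open>poly p\<close>.
\<close>

definition linear_endos :: "('k::field \<Rightarrow> 'a::field) \<Rightarrow> ('a \<Rightarrow> 'a) set" where
  "linear_endos emb = {f. Vector_Spaces.linear (ext_scale emb) (ext_scale emb) f}"

definition map_rank :: "('k::field \<Rightarrow> 'a::field) \<Rightarrow> ('a \<Rightarrow> 'a) \<Rightarrow> nat" where
  "map_rank emb f = vector_space.dim (ext_scale emb) (range f)"

definition rank_dist :: "('k::field \<Rightarrow> 'a::field) \<Rightarrow> ('a \<Rightarrow> 'a) \<Rightarrow> ('a \<Rightarrow> 'a) \<Rightarrow> nat" where
  "rank_dist emb A B = map_rank emb (\<lambda>x. A x - B x)"

definition min_dist :: "('k::field \<Rightarrow> 'a::{field,finite}) \<Rightarrow> ('a \<Rightarrow> 'a) set \<Rightarrow> nat" where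
  "min_dist emb C = Min {rank_dist emb A B | A B. A \<in> C \<and> B \<in> C \<and> A \<noteq> B}"

definition MRD_code ::
    "('k::{field,finite} \<Rightarrow> 'a::{field,finite}) \<Rightarrow> nat \<Rightarrow> ('a \<Rightarrow> 'a) set \<Rightarrow> bool" where
  "MRD_code emb m C \<longleftrightarrow>
     C \<subseteq> linear_endos emb \<and> 2 \<le> card C \<and>
     card C = CARD('k) ^ (m * (m - min_dist emb C + 1))"

end

theory Submission
  imports Defs "HOL-Number_Theory.Residues" "HOL-Library.FuncSet"
begin

text \<open>
  Let \<open>m = 2n\<close> and let \<open>\<sigma>\<close> be the power \<open>x \<mapsto> x^(q^s)\<close> of the Frobenius map. As \<open>s\<close> is coprime to
  \<open>m\<close>, the fixed field of \<open>\<sigma>\<close> is F_q, and a codeword is a \<open>\<sigma>\<close>-polynomial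
  \<open>a + c_1 \<sigma> + ... + c_{k-1} \<sigma>^{k-1} + \<gamma> b \<sigma>^k\<close>.

  The core is a statement on a \<open>\<sigma>\<close>-polynomial \<open>f = c_0 + ... + c_k \<sigma>^k\<close> with \<open>c_k\<close> nonzero
  (\<open>skew_kernel_bound\<close>): its kernel has at most \<open>q^k\<close> elements, and if it has exactly \<open>q^k\<close>, then
  \<open>N(c_0) = (-1)^(km) N(c_k)\<close>. Indeed, a nonzero \<open>u\<close> in the kernel gives a right factor
  \<open>\<sigma> - w\<close> with \<open>w = \<sigma>(u)/u\<close>. The kernel of that factor is the line F_q \<open>u\<close>, and \<open>N(w) = 1\<close>.
  So every factor that is split off costs a factor \<open>q\<close> in the size of the kernel and, up to the sign
  \<open>(-1)^m\<close>, preserves the norm of the constant coefficient.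

  For a nonzero codeword with \<open>b = 0\<close> the degree in \<open>\<sigma>\<close> is at most \<open>k - 1\<close>, and so is the
  dimension of the kernel. If \<open>b\<close> is nonzero, a kernel of dimension \<open>k\<close> would force
  \<open>N(a) = N(\<gamma>) N(b)\<close>, because \<open>m\<close> is even. But the norm to F_q of an element of F_{q^n} is the
  square of its norm from F_{q^n} to F_q, so \<open>N(\<gamma>)\<close> would be a square in F_q (\<open>norm_twist_neq\<close>).
  Hence distinct codewords have distance at least \<open>m - k + 1\<close>. In particular different parameters
  give different codewords, and there are \<open>q^n q^n (q^m)^(k-1) = q^(mk)\<close> of them.

  That the minimum distance is not larger than \<open>m - k + 1\<close> is the Singleton bound: more than
  \<open>q^(m(k-1))\<close> linear maps cannot be told apart by their values on \<open>k - 1\<close> basis vectors. Throughout, dimensions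
  are read off from cardinalities.
\<close>

section \<open>Counting with additive maps and finite vector spaces\<close>

text \<open>
  A fibre of \<open>f\<close> is a translate of the kernel: \<open>x\<close> is determined by \<open>f x\<close> and its difference to a
  chosen preimage of \<open>f x\<close>.
\<close>

lemma card_le_card_image_times_kernel:
  fixes f :: "'a::{ab_group_add,finite} \<Rightarrow> 'b::ab_group_add"
  assumes diff: "\<And>x y. f (x - y) = f x - f y"
  shows "card A \<le> card (f ` A) * card {x. f x = 0}"
proof -
  define g where "g x = (f x, x - inv_into UNIV f (f x))" for x
  have "inj g"
    by (rule injI) (auto simp: g_def)
  moreover have "g ` A \<subseteq> f ` A \<times> {x. f x = 0}"
    by (auto simp: g_def diff f_inv_into_f)
  ultimately have "card A \<le> card (f ` A \<times> {x. f x = 0})"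
    by (intro card_inj_on_le[of g]) (auto intro: inj_on_subset)
  then show ?thesis
    by (simp add: card_cartesian_product)
qed

lemma card_range_times_kernel:
  fixes f :: "'a::{ab_group_add,finite} \<Rightarrow> 'b::ab_group_add"
  assumes diff: "\<And>x y. f (x - y) = f x - f y"
  shows "card (range f) * card {x. f x = 0} = CARD('a)"
proof (rule antisym)
  have add: "f (x + y) = f x + f y" for x y
    using diff[of "x + y" y] by simp
  define g where "g = (\<lambda>(y, z). inv_into UNIV f y + z)"
  have "inj_on g (range f \<times> {x. f x = 0})"
  proof (rule inj_onI)
    fix p p' assume *: "p \<in> range f \<times> {x. f x = 0}" "p' \<in> range f \<times> {x. f x = 0}" "g p = g p'"
    have "f (g r) = fst r" if "r \<in> range f \<times> {x. f x = 0}" for r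
      using that by (auto simp: g_def add f_inv_into_f)
    then have "f (g p) = fst p" "f (g p') = fst p'"
      using * by blast+
    with *(3) have "fst p = fst p'"
      by simp
    with *(3) show "p = p'"
      by (simp add: g_def split: prod.splits)
  qed
  then have "card (range f \<times> {x. f x = 0}) \<le> CARD('a)"
    by (intro card_inj_on_le[of g]) auto
  then show "card (range f) * card {x. f x = 0} \<le> CARD('a)"
    by (simp add: card_cartesian_product)
  show "CARD('a) \<le> card (range f) * card {x. f x = 0}"
    using card_le_card_image_times_kernel[of f UNIV] diff by simp
qed

text \<open>
  Adding a basis vector \<open>b\<close> multiplies the size of the span by the size of the field, since
  \<open>(k, y) \<mapsto> k b + y\<close> is a bijection.
\<close>

lemma (in vector_space) card_span_independent:
  assumes "finite B" "independent B"
  shows "card (span B) = CARD('a) ^ card B"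
  using assms
proof (induction B rule: finite_induct)
  case (insert b B)
  from insert have indep: "independent B" and b: "b \<notin> span B"
    by (simp_all add: independent_insert)
  have "inj_on (\<lambda>(k, y). k *s b + y) (UNIV \<times> span B)"
  proof (rule inj_onI, clarify)
    fix k y k' y'
    assume y: "y \<in> span B" "y' \<in> span B" and eq: "k *s b + y = k' *s b + y'"
    have "(k - k') *s b = y' - y"
      using eq by (simp add: algebra_simps)
    then have mem: "(k - k') *s b \<in> span B"
      using y by (simp add: span_diff)
    have "k = k'"
    proof (rule ccontr)
      assume "k \<noteq> k'"
      then have "b = (1 / (k - k')) *s ((k - k') *s b)"
        by simp
      also have "\<dots> \<in> span B"
        using mem by (rule span_scale)
      finally show False
        using b by simp
    qed
    with eq show "k = k' \<and> y = y'"
      by simp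
  qed
  moreover have "(\<lambda>(k, y). k *s b + y) ` (UNIV \<times> span B) = span (insert b B)"
  proof (intro equalityI subsetI)
    fix x assume "x \<in> (\<lambda>(k, y). k *s b + y) ` (UNIV \<times> span B)"
    then obtain k y where "y \<in> span B" "x = k *s b + y"
      by auto
    then have "x - k *s b \<in> span B"
      by simp
    then show "x \<in> span (insert b B)"
      unfolding span_insert by blast
  next
    fix x assume "x \<in> span (insert b B)"
    then obtain k where "x - k *s b \<in> span B"
      unfolding span_insert by blast
    then show "x \<in> (\<lambda>(k, y). k *s b + y) ` (UNIV \<times> span B)"
      by (intro image_eqI[of _ _ "(k, x - k *s b)"]) auto
  qed
  ultimately have "card (span (insert b B)) = card ((UNIV :: 'a set) \<times> span B)"
    by (metis card_image)
  then show ?case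
    using insert indep by (simp add: card_cartesian_product)
qed simp

corollary (in vector_space) card_subspace:
  assumes "subspace S" "finite S"
  shows "card S = CARD('a) ^ dim S"
proof -
  obtain B where B: "B \<subseteq> S" "independent B" "S \<subseteq> span B" "card B = dim S"
    by (rule basis_exists)
  have "span B = S"
    using B assms(1) by (simp add: span_subspace)
  moreover have "finite B"
    using B(1) assms(2) by (rule finite_subset)
  ultimately show ?thesis
    using B card_span_independent by metis
qed

section \<open>Powers of the Frobenius map of a finite field\<close>

text \<open>
  Multiplication by \<open>x\<close> permutes the nonzero elements, so their product absorbs the factor
  \<open>x^(q-1)\<close>, where \<open>q\<close> is the size of the field.
\<close>

lemma power_card_eq_self:
  fixes x :: "'a::{field,finite}"
  shows "x ^ CARD('a) = x"
proof (cases "x = 0")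
  case True
  then show ?thesis
    by simp
next
  case False
  let ?U = "UNIV - {0 :: 'a}"
  have bij: "bij_betw (\<lambda>y. x * y) ?U ?U"
    by (rule bij_betwI[of _ _ _ "\<lambda>y. y / x"]) (use False in auto)
  have "(\<Prod>y\<in>?U. y) = (\<Prod>y\<in>?U. x * y)"
    using prod.reindex_bij_betw[OF bij, of "\<lambda>y. y"] by simp
  also have "\<dots> = x ^ card ?U * (\<Prod>y\<in>?U. y)"
    by (simp add: prod.distrib)
  finally have "x ^ (CARD('a) - 1) = 1"
    by (simp add: card_Diff_singleton)
  then have "x ^ Suc (CARD('a) - 1) = x"
    by (simp only: power_Suc mult_1_right)
  also have "Suc (CARD('a) - 1) = CARD('a)"
    using zero_less_card_finite[where ?'a = 'a] by simp
  finally show ?thesis .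
qed

text \<open>
  The cases \<open>e = 1\<close> and \<open>e = -1\<close> bound the fixed points of a power of Frobenius and the elements
  that it negates.
\<close>

lemma card_roots_power_eq_scaled:
  fixes e :: "'a::idom"
  assumes "2 \<le> N"
  shows "card {x. x ^ N = e * x} \<le> N"
proof -
  let ?p = "Polynomial.monom 1 N - Polynomial.monom e 1"
  have deg: "degree ?p \<le> N"
    using assms by (intro degree_diff_le order.trans[OF degree_monom_le]) auto
  have "Polynomial.coeff ?p N = 1"
    using assms by simp
  then have "?p \<noteq> 0"
    by (metis Polynomial.coeff_0 zero_neq_one)
  then have "card {x. poly ?p x = 0} \<le> degree ?p"
    by (rule card_poly_roots_bound)
  also have "{x. poly ?p x = 0} = {x. x ^ N = e * x}"
    by (simp add: Polynomial.poly_monom)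
  finally show ?thesis
    using deg by simp
qed

text \<open>
  The extension F_{q^m} / F_q, as an embedding of finite field types.
\<close>

locale finite_field_extension =
  fixes emb :: "'k::{field,finite} \<Rightarrow> 'a::{field,finite}" and q m :: nat
  assumes card_base: "CARD('k) = q"
    and card_ext: "CARD('a) = q ^ m"
    and emb: "field_embedding emb"
    and primepow_q: "primepow q"
begin

lemma q_ge_2: "2 \<le> q"
  using primepow_gt_Suc_0[OF primepow_q] by simp

lemma emb_simps: "emb 1 = 1" "emb (x + y) = emb x + emb y" "emb (x * y) = emb x * emb y"
  using emb by (auto simp: field_embedding_def)

lemma emb_power: "emb (x ^ i) = emb x ^ i"
  by (induction i) (simp_all add: emb_simps)

lemma emb_0: "emb 0 = 0"
  using emb_simps(2)[of 0 0] by (metis add_0_right add_left_cancel)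

lemma emb_minus: "emb (- x) = - emb x"
  using emb_simps(2)[of "- x" x] by (simp add: emb_0 eq_neg_iff_add_eq_0)

lemma inj_emb: "inj emb"
proof (rule injI)
  fix x y assume eq: "emb x = emb y"
  have "emb (x - y) = 0"
    using emb_simps(2)[of x "- y"] eq by (simp add: emb_minus)
  moreover have "emb z * emb (inverse z) = 1" if "z \<noteq> 0" for z
    using that by (simp flip: emb_simps(3) add: emb_simps(1))
  ultimately show "x = y"
    by (metis eq_iff_diff_eq_0 mult_zero_left zero_neq_one)
qed

lemma emb_power_q: "emb x ^ q = emb x"
  using power_card_eq_self[of x] by (simp add: card_base flip: emb_power)

lemma emb_power_q_power: "emb x ^ (q ^ i) = emb x"
  by (induction i) (simp_all add: power_mult emb_power_q)

text \<open>
  Elements of F_q inside the extension are recognised by the equation \<open>x^q = x\<close>: it holds on the image,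
  which already has as many elements as the equation can have roots.
\<close>

lemma range_emb: "range emb = {x. x ^ q = x}"
proof (rule card_subset_eq)
  show "range emb \<subseteq> {x. x ^ q = x}"
    by (auto simp: emb_power_q)
  then have "card (range emb) \<le> card {x :: 'a. x ^ q = x}"
    by (intro card_mono) auto
  moreover have "card (range emb) = q"
    using inj_emb by (simp add: card_image card_base)
  moreover have "card {x :: 'a. x ^ q = x} \<le> q"
    using card_roots_power_eq_scaled[OF q_ge_2, of "1 :: 'a"] by simp
  ultimately show "card (range emb) = card {x :: 'a. x ^ q = x}"
    by simp
qed simp

lemma power_q_add: "(x :: 'a) ^ (q ^ (i + j)) = (x ^ (q ^ i)) ^ (q ^ j)"
  by (simp only: power_add power_mult)

lemma power_q_m: "(x :: 'a) ^ (q ^ m) = x"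
  using power_card_eq_self[of x] by (simp add: card_ext)

lemma power_q_mult_m: "(x :: 'a) ^ (q ^ (m * i)) = x"
  by (induction i) (simp_all add: power_q_add power_q_m)

lemma power_q_mod: "(x :: 'a) ^ (q ^ i) = x ^ (q ^ (i mod m))"
proof -
  have "x ^ (q ^ i) = x ^ (q ^ (m * (i div m) + i mod m))"
    by simp
  also have "\<dots> = x ^ (q ^ (i mod m))"
    by (simp only: power_q_add power_q_mult_m)
  finally show ?thesis .
qed

lemma ext_degree_pos: "0 < m"
proof (rule ccontr)
  assume "\<not> 0 < m"
  then have "CARD('a) = 1"
    using card_ext by simp
  then obtain z where "(UNIV :: 'a set) = {z}"
    by (auto simp: card_1_singleton_iff)
  then have "(0 :: 'a) = 1"
    by (metis UNIV_I singletonD)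
  then show False
    by simp
qed

text \<open>
  The characteristic divides the order \<open>q^m\<close> of the field, so it is the prime of which \<open>q\<close> is a power.
\<close>

lemma frobenius_add: "((x :: 'a) + y) ^ (q ^ i) = x ^ (q ^ i) + y ^ (q ^ i)"
proof -
  obtain p e where p: "prime p" "q = p ^ e"
    using primepow_q by (auto simp: primepow_def)
  have char: "prime CHAR('a)"
    using finite_imp_CHAR_pos[where ?'a = 'a] prime_CHAR_semidom[where ?'a = 'a] by simp
  have "CHAR('a) dvd p ^ (e * m)"
    using CHAR_dvd_CARD[where ?'a = 'a] by (simp add: card_ext p(2) power_mult)
  then have "CHAR('a) dvd p"
    using char prime_dvd_power by blast
  then have "CHAR('a) = p"
    using char p(1) primes_dvd_imp_eq by blast
  then have "q ^ i = CHAR('a) ^ (e * i)"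
    by (simp add: p(2) power_mult)
  then show ?thesis
    using char by (rule freshmans_dream'[rotated])
qed

lemma frobenius_diff: "((x :: 'a) - y) ^ (q ^ i) = x ^ (q ^ i) - y ^ (q ^ i)"
  using frobenius_add[of "x - y" y i] by simp

text \<open>
  Since \<open>t\<close> is invertible modulo \<open>m\<close>, the \<open>q\<close>-Frobenius map is an iterate of \<open>x \<mapsto> x^(q^t)\<close>. So an
  element that the latter fixes is a root of \<open>X^q - X\<close>.
\<close>

lemma card_fixed_le:
  assumes "coprime t m" "0 < t"
  shows "card {x :: 'a. x ^ (q ^ t) = x} \<le> q"
proof -
  obtain u v where uv: "t * u = m * v + 1"
    using bezout_nat[of t m] assms by (auto simp: coprime_iff_gcd_eq_1)
  have "x ^ q = x" if fixed: "x ^ (q ^ t) = x" for x :: 'a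
  proof -
    have "x ^ (q ^ (t * i)) = x" for i
      by (induction i) (simp_all add: power_q_add fixed)
    then have "x = x ^ (q ^ (m * v + 1))"
      by (metis uv)
    also have "\<dots> = x ^ q"
      by (simp only: power_q_add power_q_mult_m power_one_right)
    finally show ?thesis
      by simp
  qed
  then have "card {x :: 'a. x ^ (q ^ t) = x} \<le> card {x :: 'a. x ^ q = 1 * x}"
    by (intro card_mono) auto
  also have "\<dots> \<le> q"
    using q_ge_2 by (rule card_roots_power_eq_scaled)
  finally show ?thesis .
qed

section \<open>The norm\<close>

abbreviation norm_q :: "'a \<Rightarrow> 'a" where
  "norm_q \<equiv> ext_norm q m"

lemma norm_mult: "norm_q (x * y) = norm_q x * norm_q y"
  by (simp add: ext_norm_def power_mult_distrib prod.distrib)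

text \<open>
  The sign comes from the \<open>m\<close> conjugates of \<open>-1\<close>, all equal to \<open>-1\<close> as \<open>-1\<close> lies in F_q.
\<close>

lemma norm_minus: "norm_q (- x) = (-1) ^ m * norm_q x"
proof -
  have "(-1) ^ (q ^ i) = (-1 :: 'a)" for i
    using emb_power_q_power[of "-1" i] by (simp add: emb_minus emb_simps)
  then have "norm_q (-1) = (-1) ^ m"
    by (simp add: ext_norm_def)
  then show ?thesis
    using norm_mult[of "-1" x] by simp
qed

lemma norm_eq_0_iff: "norm_q x = 0 \<longleftrightarrow> x = 0"
  using ext_degree_pos q_ge_2 by (auto simp: ext_norm_def)

text \<open>
  Frobenius permutes the conjugates cyclically. The degree \<open>l\<close> is that of the subfield
  containing \<open>x\<close>; both \<open>l = m\<close> and half of it occur below.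
\<close>

lemma ext_norm_frobenius:
  assumes "(x :: 'a) ^ (q ^ l) = x"
  shows "ext_norm q l x ^ q = ext_norm q l x"
proof -
  have "ext_norm q l x ^ q = (\<Prod>i<l. x ^ (q ^ Suc i))"
    by (simp add: ext_norm_def prod_power_distrib mult.commute flip: power_mult)
  moreover have "x * (\<Prod>i<l. x ^ (q ^ Suc i)) = x * ext_norm q l x"
  proof -
    have "x * (\<Prod>i<l. x ^ (q ^ Suc i)) = (\<Prod>i<Suc l. x ^ (q ^ i))"
      by (simp add: prod.lessThan_Suc_shift del: prod.lessThan_Suc)
    also have "\<dots> = x * ext_norm q l x"
      by (simp add: ext_norm_def assms mult.commute)
    finally show ?thesis .
  qed
  ultimately show ?thesis
    by (cases "x = 0") (use q_ge_2 in \<open>auto simp: ext_norm_def zero_power\<close>)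
qed

lemma norm_power_q_power: "norm_q (x ^ (q ^ i)) = norm_q x"
proof -
  have "norm_q (x ^ (q ^ i)) = norm_q x ^ (q ^ i)"
    by (simp add: ext_norm_def prod_power_distrib mult.commute flip: power_mult)
  also have "\<dots> = norm_q x"
    by (induction i) (simp_all add: power_mult ext_norm_frobenius power_q_m)
  finally show ?thesis .
qed

section \<open>Kernels of linearized polynomials\<close>

text \<open>
  The value at \<open>x\<close> of the skew polynomial \<open>c_0 + c_1 \<sigma> + ... + c_k \<sigma>^k\<close>, where
  \<open>\<sigma> x = x^(q^t)\<close>.
\<close>

definition skew_eval :: "nat \<Rightarrow> nat \<Rightarrow> (nat \<Rightarrow> 'a) \<Rightarrow> 'a \<Rightarrow> 'a" where
  "skew_eval t k c x = (\<Sum>i\<le>k. c i * x ^ (q ^ (t * i)))"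

lemma skew_eval_add: "skew_eval t k c (x + y) = skew_eval t k c x + skew_eval t k c y"
  by (simp add: skew_eval_def frobenius_add distrib_left sum.distrib)

lemma skew_eval_diff: "skew_eval t k c (x - y) = skew_eval t k c x - skew_eval t k c y"
  by (simp add: skew_eval_def frobenius_diff right_diff_distrib sum_subtractf)

lemma skew_eval_emb: "skew_eval t k c (emb a * x) = emb a * skew_eval t k c x"
  by (simp add: skew_eval_def sum_distrib_left power_mult_distrib emb_power_q_power mult_ac)

lemma skew_eval_zero: "skew_eval t k c 0 = 0"
  using skew_eval_diff[of t k c 0 0] by simp

text \<open>
  Right division with remainder by \<open>\<sigma> - w\<close> in the skew polynomial ring, where
  \<open>\<sigma> z = \<sigma>(z) \<sigma>\<close>: the quotient is \<open>d\<close>, the remainder the constant \<open>e\<close>. The relations for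
  \<open>d k\<close> and \<open>d 0\<close> are what the norms of the outer coefficients need. The leading term
  \<open>a \<sigma>^(k+2)\<close> is removed by subtracting \<open>a \<sigma>^(k+1) (\<sigma> - w)\<close>, which changes only the coefficient
  next to it.
\<close>

lemma skew_right_division:
  "\<exists>d e. d k = c (Suc k) \<and> c 0 = e - d 0 * w \<and>
     (\<forall>x. skew_eval t (Suc k) c x = skew_eval t k d (x ^ (q ^ t) - w * x) + e * x)"
proof (induction k arbitrary: c)
  case 0
  show ?case
    by (rule exI[of _ "\<lambda>_. c 1"], rule exI[of _ "c 0 + c 1 * w"])
      (simp add: skew_eval_def algebra_simps)
next
  case (Suc k)
  define a where "a = c (Suc (Suc k))"
  define c' where "c' = c(Suc k := c (Suc k) + a * w ^ (q ^ (t * Suc k)))"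
  obtain d e where d: "d k = c' (Suc k)" "c' 0 = e - d 0 * w"
    and eval: "\<And>x. skew_eval t (Suc k) c' x = skew_eval t k d (x ^ (q ^ t) - w * x) + e * x"
    using Suc.IH[of c'] by blast
  have c'_low: "(\<Sum>i\<le>k. c' i * x ^ (q ^ (t * i))) = (\<Sum>i\<le>k. c i * x ^ (q ^ (t * i)))" for x
    by (rule sum.cong) (auto simp: c'_def)
  have d_low: "skew_eval t k (d(Suc k := a)) y = skew_eval t k d y" for y
    unfolding skew_eval_def by (rule sum.cong) auto
  have top: "(x ^ (q ^ t) - w * x) ^ (q ^ (t * Suc k)) =
      x ^ (q ^ (t * Suc (Suc k))) - w ^ (q ^ (t * Suc k)) * x ^ (q ^ (t * Suc k))" for x
    by (simp only: frobenius_diff power_mult_distrib flip: power_q_add) simp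
  have "skew_eval t (Suc (Suc k)) c x =
      skew_eval t (Suc k) c' x + a * (x ^ (q ^ t) - w * x) ^ (q ^ (t * Suc k))" for x
    unfolding top using c'_low[of x]
    by (simp add: skew_eval_def c'_def a_def algebra_simps del: fun_upd_apply) (simp add: algebra_simps)
  then have "skew_eval t (Suc (Suc k)) c x =
      skew_eval t (Suc k) (d(Suc k := a)) (x ^ (q ^ t) - w * x) + e * x" for x
    using eval[of x] d_low[of "x ^ (q ^ t) - w * x"] by (simp add: skew_eval_def)
  moreover have "(d(Suc k := a)) (Suc k) = c (Suc (Suc k))" "c 0 = e - (d(Suc k := a)) 0 * w"
    using d by (simp_all add: a_def c'_def)
  ultimately show ?case
    by blast
qed

text \<open>
  The induction splits off the right factor \<open>\<sigma> - w\<close> that belongs to a nonzero element of the kernel. If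
  the bound is attained for the product, it is attained for the left factor as well, so the norm
  relation can be passed on.
\<close>

lemma skew_kernel_bound:
  assumes t: "coprime t m" "0 < t" and "c k \<noteq> 0"
  shows "card {x. skew_eval t k c x = 0} \<le> q ^ k \<and>
    (card {x. skew_eval t k c x = 0} = q ^ k \<longrightarrow> norm_q (c 0) = (-1) ^ (k * m) * norm_q (c k))"
  using \<open>c k \<noteq> 0\<close>
proof (induction k arbitrary: c)
  case 0
  then have "{x. skew_eval t 0 c x = 0} = {0}"
    by (auto simp: skew_eval_def)
  then show ?case
    by simp
next
  case (Suc k)
  show ?case
  proof (cases "{x. skew_eval t (Suc k) c x = 0} \<subseteq> {0}")
    case True
    then have "card {x. skew_eval t (Suc k) c x = 0} \<le> 1"
      using card_mono[OF _ True] by simp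
    moreover have "1 < q ^ Suc k"
      using q_ge_2 by (intro one_less_power) auto
    ultimately show ?thesis
      by linarith
  next
    case False
    then obtain u where u: "skew_eval t (Suc k) c u = 0" "u \<noteq> 0"
      by auto
    define w where "w = u ^ (q ^ t) / u"
    define L where "L x = x ^ (q ^ t) - w * x" for x
    obtain d e where d: "d k = c (Suc k)" "c 0 = e - d 0 * w"
      and eval: "\<And>x. skew_eval t (Suc k) c x = skew_eval t k d (L x) + e * x"
      using skew_right_division[where c = c and k = k and w = w and t = t] unfolding L_def by blast
    \<comment> \<open>Both the polynomial and the factor kill u, so the remainder vanishes.\<close>
    have "L u = 0"
      using u by (simp add: L_def w_def)
    then have "e = 0"
      using eval[of u] u by (simp add: skew_eval_zero)
    have IH: "card {y. skew_eval t k d y = 0} \<le> q ^ k"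
      "card {y. skew_eval t k d y = 0} = q ^ k \<Longrightarrow> norm_q (d 0) = (-1) ^ (k * m) * norm_q (d k)"
      using Suc.IH[of d] Suc.prems d(1) by auto
    have L_diff: "L (x - y) = L x - L y" for x y
      by (simp add: L_def frobenius_diff algebra_simps)
    have "card {x. L x = 0} \<le> card {z :: 'a. z ^ (q ^ t) = z}"
    proof (rule card_inj_on_le)
      \<comment> \<open>The kernel of the factor consists of the multiples of u by fixed elements.\<close>
      show "inj_on (\<lambda>x. x / u) {x. L x = 0}"
        using u by (auto intro!: inj_onI)
      show "(\<lambda>x. x / u) ` {x. L x = 0} \<subseteq> {z. z ^ (q ^ t) = z}"
        using u by (auto simp: L_def w_def power_divide field_simps)
    qed simp
    then have ker_L: "card {x. L x = 0} \<le> q"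
      using card_fixed_le[OF t] by simp
    have "card {x. skew_eval t (Suc k) c x = 0}
        \<le> card (L ` {x. skew_eval t (Suc k) c x = 0}) * card {x. L x = 0}"
      using L_diff by (rule card_le_card_image_times_kernel)
    also have "\<dots> \<le> card {y. skew_eval t k d y = 0} * q"
      using ker_L eval \<open>e = 0\<close> by (intro mult_mono card_mono) auto
    finally have le: "card {x. skew_eval t (Suc k) c x = 0} \<le> card {y. skew_eval t k d y = 0} * q" .
    show ?thesis
    proof (intro conjI impI)
      show "card {x. skew_eval t (Suc k) c x = 0} \<le> q ^ Suc k"
        using order.trans[OF le mult_le_mono1[OF IH(1)]] by (simp add: mult.commute)
      assume "card {x. skew_eval t (Suc k) c x = 0} = q ^ Suc k"
      then have "card {y. skew_eval t k d y = 0} = q ^ k"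
        using le IH(1) q_ge_2 by (simp add: mult.commute)
      then have "norm_q (d 0) = (-1) ^ (k * m) * norm_q (c (Suc k))"
        using IH(2) d(1) by simp
      moreover have "norm_q w = 1"
      proof -
        have "norm_q w * norm_q u = norm_q u"
          using u by (simp add: w_def norm_power_q_power flip: norm_mult)
        then show ?thesis
          using u by (simp add: norm_eq_0_iff)
      qed
      moreover have "norm_q (c 0) = (-1) ^ m * norm_q (d 0 * w)"
        using d(2) \<open>e = 0\<close> by (simp add: norm_minus)
      ultimately show "norm_q (c 0) = (-1) ^ (Suc k * m) * norm_q (c (Suc k))"
        by (simp add: norm_mult power_add mult.commute)
    qed
  qed
qed

text \<open>
  The leading coefficient may vanish here; the bound is then one for a smaller degree.
\<close>

corollary skew_kernel_le:
  assumes "coprime t m" "0 < t" and "\<exists>i\<le>k. c i \<noteq> 0"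
  shows "card {x. skew_eval t k c x = 0} \<le> q ^ k"
  using assms(3)
proof (induction k)
  case 0
  then show ?case
    using skew_kernel_bound[OF assms(1,2), of c 0] by simp
next
  case (Suc k)
  show ?case
  proof (cases "c (Suc k) = 0")
    case True
    then have "card {x. skew_eval t (Suc k) c x = 0} \<le> q ^ k"
      using Suc by (auto simp: skew_eval_def le_Suc_eq)
    also have "\<dots> \<le> q ^ Suc k"
      using q_ge_2 by simp
    finally show ?thesis .
  next
    case False
    then show ?thesis
      using skew_kernel_bound[OF assms(1,2)] by blast
  qed
qed

section \<open>Rank-metric codes\<close>

lemma vector_space_ext: "vector_space (ext_scale emb)"
  by standard (simp_all add: ext_scale_def emb_simps algebra_simps)

sublocale ext: vector_space "ext_scale emb"
  by (rule vector_space_ext)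

lemma linear_endos_iff:
  "f \<in> linear_endos emb \<longleftrightarrow>
     (\<forall>x y. f (x + y) = f x + f y) \<and> (\<forall>c x. f (emb c * x) = emb c * f x)"
  by (simp add: linear_endos_def Vector_Spaces.linear_iff vector_space_ext ext_scale_def)

lemma linear_endos_diff:
  assumes "f \<in> linear_endos emb" "g \<in> linear_endos emb"
  shows "(\<lambda>x. f x - g x) \<in> linear_endos emb"
  using assms by (auto simp: linear_endos_iff algebra_simps)

text \<open>
  Rank-nullity, stated with the size of the kernel in place of its dimension.
\<close>

lemma
  assumes "f \<in> linear_endos emb"
  shows map_rank_le: "map_rank emb f \<le> m"
    and card_kernel: "card {x. f x = 0} = q ^ (m - map_rank emb f)"
proof -
  let ?r = "map_rank emb f" and ?c = "card {x. f x = 0}"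
  have q: "1 < q"
    using q_ge_2 by simp
  interpret f: Vector_Spaces.linear "ext_scale emb" "ext_scale emb" f
    using assms by (simp add: linear_endos_def)
  have "ext.subspace (range f)"
    by (rule f.subspace_image) simp
  then have "card (range f) = q ^ ?r"
    using ext.card_subspace[of "range f"] by (simp add: map_rank_def card_base)
  then have eq: "q ^ ?r * ?c = q ^ m"
    using card_range_times_kernel[of f] f.diff by (simp add: card_ext)
  then have "0 < ?c"
    using q by (cases ?c) auto
  then have "q ^ ?r \<le> q ^ m"
    unfolding eq[symmetric] by (simp add: Suc_le_eq)
  then show r: "?r \<le> m"
    using q by simp
  have "q ^ ?r * ?c = q ^ ?r * q ^ (m - ?r)"
    using eq r by (simp flip: power_add)
  then show "?c = q ^ (m - ?r)"
    using q by simp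
qed

lemma rank_iff_card_kernel:
  assumes "f \<in> linear_endos emb" "j \<le> m"
  shows "m - j \<le> map_rank emb f \<longleftrightarrow> card {x. f x = 0} \<le> q ^ j"
    and "map_rank emb f \<le> m - j \<longleftrightarrow> q ^ j \<le> card {x. f x = 0}"
  using q_ge_2 map_rank_le[OF assms(1)] assms(2) by (auto simp: card_kernel[OF assms(1)])

text \<open>
  By the pigeonhole principle two members of \<open>C\<close> agree on \<open>j\<close> basis vectors, hence on their span,
  which has \<open>q^j\<close> elements.
\<close>

lemma singleton_bound:
  assumes C: "C \<subseteq> linear_endos emb" and j: "j \<le> m" and card: "q ^ (m * j) < card C"
  shows "\<exists>A\<in>C. \<exists>B\<in>C. A \<noteq> B \<and> rank_dist emb A B \<le> m - j"
proof -
  obtain B where B: "ext.independent B" "ext.span B = UNIV" "finite B"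
    using ext.basis_exists[of UNIV] by (metis finite_class.finite top.extremum_uniqueI)
  then have "q ^ card B = q ^ m"
    using ext.card_span_independent[of B] by (simp add: card_base card_ext)
  then have "card B = m"
    using q_ge_2 by simp
  then obtain S where S: "S \<subseteq> B" "card S = j"
    using j obtain_subset_with_card_n by metis
  have fin: "finite S"
    by simp
  have indep: "ext.independent S"
    using B(1) S(1) by (rule ext.independent_mono)
  have "card (S \<rightarrow>\<^sub>E (UNIV :: 'a set)) = q ^ (m * j)"
    using fin S(2) by (simp add: card_PiE card_ext power_mult)
  moreover have "(\<lambda>f. restrict f S) ` C \<subseteq> S \<rightarrow>\<^sub>E UNIV"
    by auto
  moreover have "finite (S \<rightarrow>\<^sub>E (UNIV :: 'a set))"
    using fin by (intro finite_PiE) auto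
  ultimately have "\<not> inj_on (\<lambda>f. restrict f S) C"
    using card card_inj_on_le[of "\<lambda>f. restrict f S" C "S \<rightarrow>\<^sub>E UNIV"] by auto
  then obtain f g where fg: "f \<in> C" "g \<in> C" "f \<noteq> g" "restrict f S = restrict g S"
    by (auto simp: inj_on_def)
  have lin: "(\<lambda>x. f x - g x) \<in> linear_endos emb"
    using fg C by (intro linear_endos_diff) auto
  then interpret h: Vector_Spaces.linear "ext_scale emb" "ext_scale emb" "\<lambda>x. f x - g x"
    by (simp add: linear_endos_def)
  have "f x - g x = 0" if "x \<in> S" for x
    using fg(4) that by (metis eq_iff_diff_eq_0 restrict_apply')
  then have "ext.span S \<subseteq> {x. f x - g x = 0}"
    using h.eq_0_on_span by blast
  then have "card (ext.span S) \<le> card {x. f x - g x = 0}"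
    by (intro card_mono) auto
  then have "q ^ j \<le> card {x. f x - g x = 0}"
    using ext.card_span_independent[OF fin indep] S(2) by (simp add: card_base)
  then have "rank_dist emb f g \<le> m - j"
    using rank_iff_card_kernel(2)[OF lin j] by (simp add: rank_dist_def)
  then show ?thesis
    using fg by blast
qed

text \<open>
  For a code of size \<open>q^(mk)\<close> it is enough to bound the distance from below; the Singleton bound
  supplies the other inequality.
\<close>

lemma MRD_codeI:
  assumes C: "C \<subseteq> linear_endos emb" and card: "card C = q ^ (m * k)" and k: "1 \<le> k" "k \<le> m"
    and sep: "\<And>A B. A \<in> C \<Longrightarrow> B \<in> C \<Longrightarrow> A \<noteq> B \<Longrightarrow> card {x. A x = B x} \<le> q ^ (k - 1)"
  shows "MRD_code emb m C"
proof -
  have q: "1 < q"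
    using q_ge_2 by simp
  let ?D = "{rank_dist emb A B | A B. A \<in> C \<and> B \<in> C \<and> A \<noteq> B}"
  have "finite ?D"
    by (rule finite_subset[of _ "(\<lambda>(A, B). rank_dist emb A B) ` (C \<times> C)"]) auto
  have low: "m - (k - 1) \<le> d" if d: "d \<in> ?D" for d
  proof -
    obtain A B where AB: "A \<in> C" "B \<in> C" "A \<noteq> B" "d = rank_dist emb A B"
      using d by blast
    then have "(\<lambda>x. A x - B x) \<in> linear_endos emb"
      using C by (intro linear_endos_diff) auto
    then show ?thesis
      using sep[OF AB(1-3)] k rank_iff_card_kernel(1)[of "\<lambda>x. A x - B x" "k - 1"]
      by (simp add: AB(4) rank_dist_def)
  qed
  have "q ^ (m * (k - 1)) < card C"
    using card q k ext_degree_pos by simp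
  then obtain d where "d \<in> ?D" "d \<le> m - (k - 1)"
    using singleton_bound[OF C, of "k - 1"] k by fastforce
  then have "Min ?D = m - (k - 1)"
    using \<open>finite ?D\<close> low by (metis (no_types, lifting) Min_eqI antisym)
  then have "min_dist emb C = m - (k - 1)"
    by (simp add: min_dist_def)
  then have "m - min_dist emb C + 1 = k"
    using k by simp
  moreover have "2 \<le> card C"
  proof -
    have "q ^ 1 \<le> card C"
      unfolding card using q k ext_degree_pos by (intro power_increasing) (auto simp: Suc_le_eq)
    then show ?thesis
      using q_ge_2 by simp
  qed
  ultimately show ?thesis
    using C card by (simp add: MRD_code_def card_base)
qed

lemma skew_eval_linear: "skew_eval t k c \<in> linear_endos emb"
  by (simp add: linear_endos_iff skew_eval_add skew_eval_emb)

text \<open>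
  Reducing the exponents modulo \<open>m\<close> does not change the induced map. So \<open>s\<close> may be replaced by its
  residue, and the monomials become iterates of one map.
\<close>

lemma poly_qmonom:
  "poly (qmonom q m c (int i * s)) (x :: 'a) = c * x ^ (q ^ (nat (s mod int m) * i))"
proof -
  let ?t = "nat (s mod int m)"
  have "int ?t = s mod int m"
    using ext_degree_pos by simp
  then have "int (?t * i mod m) = (s mod int m) * int i mod int m"
    by (simp only: zmod_int of_nat_mult)
  also have "\<dots> = int i * s mod int m"
    by (metis mod_mult_left_eq mult.commute)
  finally have "int i * s mod int m = int (?t * i mod m)"
    by (rule sym)
  then have "nat (int i * s mod int m) = ?t * i mod m"
    by simp
  then show ?thesis
    using power_q_mod[of x "?t * i"] by (simp add: qmonom_def Polynomial.poly_monom)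
qed

end

section \<open>The twisted code in even degree\<close>

text \<open>
  The integer \<open>s\<close> of the code enters only through its residue modulo \<open>2n\<close>, which \<open>t\<close> stands for.
\<close>

locale twisted_code = finite_field_extension emb q "2 * n"
  for emb :: "'k::{field,finite} \<Rightarrow> 'a::{field,finite}" and q n :: nat +
  fixes t k :: nat and \<gamma> :: 'a and N\<gamma> :: 'k
  assumes coprime_t: "coprime t (2 * n)" and t_pos: "0 < t" and k: "1 \<le> k" "k < 2 * n"
    and norm_\<gamma>: "emb N\<gamma> = norm_q \<gamma>" and nonsquare: "\<And>y. N\<gamma> \<noteq> y ^ 2"
begin

text \<open>
  The map \<open>T x = x^(q^n) - x\<close> has the subfield as its kernel. Its image consists of elements that
  \<open>x \<mapsto> x^(q^n)\<close> negates, because that map is an involution. So the image has at most \<open>q^n\<close>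
  elements, which leaves at least \<open>q^n\<close> for the kernel.
\<close>

lemma card_fixed_subfield: "card (fixed_subfield q n :: 'a set) = q ^ n"
proof (rule antisym)
  have n: "0 < n"
    using ext_degree_pos by simp
  have "2 ^ 1 \<le> q ^ n"
    using q_ge_2 n by (intro order.trans[OF power_mono[of 2 q 1] power_increasing]) auto
  then have q_n: "2 \<le> q ^ n"
    by simp
  show "card (fixed_subfield q n :: 'a set) \<le> q ^ n"
    using card_roots_power_eq_scaled[OF q_n, of "1 :: 'a"] by (simp add: fixed_subfield_def)
  define T :: "'a \<Rightarrow> 'a" where "T x = x ^ (q ^ n) - x" for x
  have T_diff: "T (x - y) = T x - T y" for x y
    by (simp add: T_def frobenius_diff)
  have "T x ^ (q ^ n) = -1 * T x" for x
    using power_q_m[of x] by (simp add: T_def frobenius_diff mult_2 power_q_add)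
  then have "card (range T) \<le> card {y :: 'a. y ^ (q ^ n) = -1 * y}"
    by (intro card_mono) auto
  also have "\<dots> \<le> q ^ n"
    using q_n by (rule card_roots_power_eq_scaled)
  finally have range: "card (range T) \<le> q ^ n" .
  have "q ^ n * q ^ n = card (range T) * card {x. T x = 0}"
    using card_range_times_kernel[of T] T_diff by (simp add: card_ext mult_2 power_add)
  also have "{x. T x = 0} = fixed_subfield q n"
    by (simp add: T_def fixed_subfield_def)
  also have "card (range T) * card (fixed_subfield q n :: 'a set)
      \<le> q ^ n * card (fixed_subfield q n :: 'a set)"
    using range by (rule mult_le_mono1)
  finally show "q ^ n \<le> card (fixed_subfield q n :: 'a set)"
    by (rule mult_left_le_imp_le) (use q_n in linarith)
qed

text \<open>
  The conjugates of \<open>a\<close> repeat with period \<open>n\<close>, so the norm is the square of the norm from F_{q^n}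
  to F_q, and the latter lies in F_q.
\<close>

lemma norm_fixed_subfield_square:
  assumes "a \<in> fixed_subfield q n"
  shows "\<exists>y. norm_q a = emb (y ^ 2)"
proof -
  have fixed: "a ^ (q ^ n) = a"
    using assms by (simp add: fixed_subfield_def)
  have "(\<Prod>i<n + l. a ^ (q ^ i)) = (\<Prod>i<n. a ^ (q ^ i)) * (\<Prod>i<l. a ^ (q ^ (n + i)))" for l
    by (induction l) (simp_all add: mult.assoc)
  then have "norm_q a = ext_norm q n a * (\<Prod>i<n. a ^ (q ^ (n + i)))"
    by (simp add: ext_norm_def mult_2)
  also have "\<dots> = ext_norm q n a ^ 2"
    by (simp only: power_q_add fixed) (simp add: ext_norm_def power2_eq_square)
  finally have "norm_q a = ext_norm q n a ^ 2" .
  moreover have "ext_norm q n a \<in> range emb"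
    unfolding range_emb using ext_norm_frobenius[OF fixed] by simp
  ultimately show ?thesis
    by (auto simp: emb_power)
qed

text \<open>
  Otherwise \<open>N(\<gamma>) = N(a) / N(b)\<close> would be a quotient of squares.
\<close>

lemma norm_twist_neq:
  assumes "a \<in> fixed_subfield q n" "b \<in> fixed_subfield q n" "b \<noteq> 0"
  shows "norm_q a \<noteq> norm_q (\<gamma> * b)"
proof
  assume eq: "norm_q a = norm_q (\<gamma> * b)"
  obtain y z where yz: "norm_q a = emb (y ^ 2)" "norm_q b = emb (z ^ 2)"
    using assms norm_fixed_subfield_square by blast
  have "z \<noteq> 0"
    using yz(2) assms(3) norm_eq_0_iff[of b] by (auto simp: emb_0)
  have "emb (y ^ 2) = emb (N\<gamma> * z ^ 2)"
    using eq yz by (simp add: norm_mult norm_\<gamma> emb_simps)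
  then have "y ^ 2 = N\<gamma> * z ^ 2"
    using inj_emb by (rule injD[rotated])
  then have "N\<gamma> = (y / z) ^ 2"
    using \<open>z \<noteq> 0\<close> by (simp add: power_divide)
  then show False
    using nonsquare by blast
qed

lemma \<gamma>_nonzero: "\<gamma> \<noteq> 0"
proof
  assume "\<gamma> = 0"
  then have "emb N\<gamma> = emb (0 ^ 2)"
    using norm_\<gamma> norm_eq_0_iff[of 0] by (simp add: emb_0)
  then show False
    using inj_emb nonsquare by (metis injD)
qed

definition twisted_coeffs :: "'a \<Rightarrow> 'a \<Rightarrow> (nat \<Rightarrow> 'a) \<Rightarrow> nat \<Rightarrow> 'a" where
  "twisted_coeffs a b c i = (if i = 0 then a else if i = k then \<gamma> * b else c i)"

abbreviation codeword :: "'a \<Rightarrow> 'a \<Rightarrow> (nat \<Rightarrow> 'a) \<Rightarrow> 'a \<Rightarrow> 'a" where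
  "codeword a b c \<equiv> skew_eval t k (twisted_coeffs a b c)"

lemma codeword_expand:
  "codeword a b c x = a * x + (\<Sum>i = 1..k - 1. c i * x ^ (q ^ (t * i))) + \<gamma> * b * x ^ (q ^ (t * k))"
proof -
  have "{..k} = insert 0 (insert k {1..k - 1})"
    using k by auto
  then have "codeword a b c x = a * x + (\<gamma> * b * x ^ (q ^ (t * k)) +
      (\<Sum>i = 1..k - 1. twisted_coeffs a b c i * x ^ (q ^ (t * i))))"
    using k by (simp add: skew_eval_def twisted_coeffs_def)
  also have "(\<Sum>i = 1..k - 1. twisted_coeffs a b c i * x ^ (q ^ (t * i))) =
      (\<Sum>i = 1..k - 1. c i * x ^ (q ^ (t * i)))"
    using k by (intro sum.cong) (auto simp: twisted_coeffs_def)
  finally show ?thesis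
    by (simp add: add_ac)
qed

lemma codeword_diff:
  "codeword a b c x - codeword a' b' c' x = codeword (a - a') (b - b') (\<lambda>i. c i - c' i) x"
  by (simp add: codeword_expand algebra_simps sum_subtractf)

text \<open>
  If \<open>b\<close> is nonzero, the degree is \<open>k\<close> and the generic bound is one too weak. The norms exclude
  equality, and as the size of the kernel is a power of \<open>q\<close>, it then is at most \<open>q^(k-1)\<close>.
\<close>

lemma codeword_kernel_le:
  assumes a: "a \<in> fixed_subfield q n" and b: "b \<in> fixed_subfield q n"
    and nz: "a \<noteq> 0 \<or> b \<noteq> 0 \<or> (\<exists>i\<in>{1..k - 1}. c i \<noteq> 0)"
  shows "card {x. codeword a b c x = 0} \<le> q ^ (k - 1)"
proof (cases "b = 0")
  case True
  obtain l where l: "k = Suc l"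
    using k by (cases k) auto
  have "twisted_coeffs a b c k = 0"
    using True k by (simp add: twisted_coeffs_def)
  then have "codeword a b c x = skew_eval t l (twisted_coeffs a b c) x" for x
    unfolding skew_eval_def using l by simp
  moreover have "\<exists>i\<le>l. twisted_coeffs a b c i \<noteq> 0"
  proof (cases "a = 0")
    case a_zero: True
    then obtain i where "i \<in> {1..k - 1}" "c i \<noteq> 0"
      using nz True by blast
    moreover from this have "i \<noteq> 0" "i \<noteq> k" "i \<le> l"
      using l by auto
    ultimately show ?thesis
      by (intro exI[of _ i]) (simp add: twisted_coeffs_def)
  next
    case False
    then show ?thesis
      by (intro exI[of _ 0]) (simp add: twisted_coeffs_def)
  qed
  ultimately show ?thesis
    using skew_kernel_le[OF coprime_t t_pos, of l "twisted_coeffs a b c"] l by simp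
next
  case False
  let ?c = "card {x. codeword a b c x = 0}"
  have top: "twisted_coeffs a b c k = \<gamma> * b" and bottom: "twisted_coeffs a b c 0 = a"
    using k by (simp_all add: twisted_coeffs_def)
  have "twisted_coeffs a b c k \<noteq> 0"
    using False \<gamma>_nonzero by (simp add: top)
  note bound = skew_kernel_bound[OF coprime_t t_pos, of "twisted_coeffs a b c" k, OF this]
  have "(-1) ^ (k * (2 * n)) * norm_q (\<gamma> * b) = norm_q (\<gamma> * b)"
    by simp
  then have "?c \<noteq> q ^ k"
    using bound norm_twist_neq[OF a b False] unfolding top bottom by metis
  then have "?c < q ^ k"
    using bound by linarith
  moreover have c: "?c = q ^ (2 * n - map_rank emb (codeword a b c))"
    using skew_eval_linear by (rule card_kernel)
  ultimately have "2 * n - map_rank emb (codeword a b c) \<le> k - 1"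
    using q_ge_2 by simp
  then show ?thesis
    using q_ge_2 by (simp add: c)
qed

text \<open>
  The coefficients are functions that are fixed outside \<open>1, ..., k - 1\<close>, so that each codeword comes
  from one parameter only.
\<close>

definition parameters :: "('a \<times> 'a \<times> (nat \<Rightarrow> 'a)) set" where
  "parameters = fixed_subfield q n \<times> fixed_subfield q n \<times> ({1..k - 1} \<rightarrow>\<^sub>E UNIV)"

lemma card_parameters: "card parameters = q ^ (2 * n * k)"
proof -
  have "card parameters = q ^ n * (q ^ n * (q ^ (2 * n)) ^ (k - 1))"
    by (simp add: parameters_def card_cartesian_product card_fixed_subfield card_PiE card_ext)
  also have "\<dots> = q ^ (n + (n + 2 * n * (k - 1)))"
    by (simp only: power_add power_mult)
  also have "n + (n + 2 * n * (k - 1)) = 2 * n * k"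
    using k by (cases k) auto
  finally show ?thesis .
qed

text \<open>
  The code is closed under differences, so this is the kernel bound for the difference of the parameters.
  It yields the minimum distance and also that different parameters give different maps.
\<close>

lemma card_codewords_agree_le:
  assumes "(a, b, c) \<in> parameters" "(a', b', c') \<in> parameters" "(a, b, c) \<noteq> (a', b', c')"
  shows "card {x. codeword a b c x = codeword a' b' c' x} \<le> q ^ (k - 1)"
proof -
  have "a - a' \<noteq> 0 \<or> b - b' \<noteq> 0 \<or> (\<exists>i\<in>{1..k - 1}. c i - c' i \<noteq> 0)"
    using assms by (auto simp: parameters_def dest: PiE_ext)
  moreover have "a - a' \<in> fixed_subfield q n" "b - b' \<in> fixed_subfield q n"
    using assms by (auto simp: parameters_def fixed_subfield_def frobenius_diff)
  ultimately have "card {x. codeword (a - a') (b - b') (\<lambda>i. c i - c' i) x = 0} \<le> q ^ (k - 1)"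
    by (intro codeword_kernel_le)
  then show ?thesis
    by (simp flip: codeword_diff)
qed

theorem codewords_MRD: "MRD_code emb (2 * n) ((\<lambda>(a, b, c). codeword a b c) ` parameters)"
proof (rule MRD_codeI[OF _ _ k(1) less_imp_le[OF k(2)]])
  let ?C = "(\<lambda>(a, b, c). codeword a b c) ` parameters"
  show "?C \<subseteq> linear_endos emb"
    using skew_eval_linear by auto
  have "inj_on (\<lambda>(a, b, c). codeword a b c) parameters"
  proof (rule inj_onI, rule ccontr)
    fix v v' assume v: "v \<in> parameters" "v' \<in> parameters" "v \<noteq> v'"
      and agree: "(case v of (a, b, c) \<Rightarrow> codeword a b c) = (case v' of (a, b, c) \<Rightarrow> codeword a b c)"
    obtain a b c a' b' c' where abc: "v = (a, b, c)" "v' = (a', b', c')"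
      by (metis prod_cases3)
    with agree have eq: "codeword a b c = codeword a' b' c'"
      by simp
    have "q ^ (2 * n) \<le> q ^ (k - 1)"
      using card_codewords_agree_le[OF v[unfolded abc]] eq by (simp add: card_ext)
    then show False
      using q_ge_2 k by simp
  qed
  then show "card ?C = q ^ (2 * n * k)"
    by (simp add: card_image card_parameters)
  show "card {x. A x = B x} \<le> q ^ (k - 1)" if AB: "A \<in> ?C" "B \<in> ?C" "A \<noteq> B" for A B
  proof -
    obtain a b c a' b' c' where "(a, b, c) \<in> parameters" "A = codeword a b c"
      "(a', b', c') \<in> parameters" "B = codeword a' b' c'"
      using AB(1,2) by auto
    moreover from this have "(a, b, c) \<noteq> (a', b', c')"
      using AB(3) by auto
    ultimately show ?thesis
      using card_codewords_agree_le by simp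
  qed
qed

lemma D_poly_eq_codewords:
  assumes "t = nat (s mod int (2 * n))"
  shows "poly ` D_poly q n k s \<gamma> = (\<lambda>(a, b, c). codeword a b c) ` parameters"
proof -
  define P where "P a b c = qmonom q (2 * n) a 0
      + (\<Sum>i = 1..k - 1. qmonom q (2 * n) (c i) (int i * s))
      + qmonom q (2 * n) (\<gamma> * b) (int k * s)" for a b and c :: "nat \<Rightarrow> 'a"
  have P: "poly (P a b c) = codeword a b c" for a b c
  proof
    fix x
    have "poly (qmonom q (2 * n) a 0) x = a * x"
      using poly_qmonom[of a 0 s x] by simp
    then show "poly (P a b c) x = codeword a b c x"
      by (simp add: P_def poly_sum poly_qmonom[where s = s, folded assms] codeword_expand)
  qed
  have "codeword a b c = codeword a b (restrict c {1..k - 1})" for a b c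
    by (rule ext) (simp add: codeword_expand)
  then have "codeword a b c \<in> (\<lambda>(a, b, c). codeword a b c) ` parameters"
    if "a \<in> fixed_subfield q n" "b \<in> fixed_subfield q n" for a b c
    using that by (intro image_eqI[of _ _ "(a, b, restrict c {1..k - 1})"]) (auto simp: parameters_def)
  moreover have "D_poly q n k s \<gamma> =
      {P a b c | a b c. a \<in> fixed_subfield q n \<and> b \<in> fixed_subfield q n}"
    by (auto simp: D_poly_def P_def)
  ultimately show ?thesis
    by (auto simp: P[symmetric] parameters_def image_iff)
qed

end

theorem theorem3:
  fixes emb :: "'k::{field,finite} \<Rightarrow> 'a::{field,finite}"
    and q n k :: nat and s :: int and \<gamma> :: 'a and N\<gamma> :: 'k
  assumes "primepow q" and "n \<ge> 1"
    and "CARD('k) = q" and "CARD('a) = q ^ (2 * n)"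
    and "field_embedding emb"
    and "gcd s (2 * int n) = 1"
    and "1 \<le> k" and "k \<le> 2 * n - 1"
    and "emb N\<gamma> = ext_norm q (2 * n) \<gamma>"
    and "\<not> (\<exists>y. N\<gamma> = y ^ 2)"
  shows "MRD_code emb (2 * n) (poly ` D_poly q n k s \<gamma>)"
proof -
  define t where "t = nat (s mod int (2 * n))"
  have t: "int t = s mod int (2 * n)"
    using assms(2) by (simp add: t_def)
  have "gcd (int t) (int (2 * n)) = 1"
    unfolding t using assms(6) by (simp add: gcd.commute flip: gcd_red_int)
  then have "coprime (int t) (int (2 * n))"
    by (simp only: coprime_iff_gcd_eq_1)
  then have coprime: "coprime t (2 * n)"
    by (simp only: coprime_int_iff)
  moreover have "0 < t"
    using coprime assms(2) by (cases "t = 0") auto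
  ultimately interpret twisted_code emb q n t k \<gamma> N\<gamma>
    using assms by unfold_locales auto
  show ?thesis
    unfolding D_poly_eq_codewords[OF t_def] by (rule codewords_MRD)
qed

end
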